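(* Let $G$ be a graph with $n=|V(G)|$. Let $\mathcal{I}$ be the set of all independent sets of cardinality $n$ of $G(k)$, taken over all integers $1\le k\le n$. Then $$\Gamma_{\rho}(G)=\max_{A\in\mathcal{I}}\{DMP(A)\}.$$
   Context: All graphs are finite and simple; $d_G(u,v)$ is the distance in $G$. A packing coloring $c:V(G)\to\{1,\dots,k\}$ is one in which $c(u)=c(v)=i$, $u\ne v$, implies $d_G(u,v)>i$. A greedy packing coloring is a packing coloring produced by the greedy procedure that processes the vertices in some order and assigns each vertex the smallest color $i$ such that no already-colored vertex of color $i$ is at distance at most $i$; equivalently, a packing coloring in which every vertex of color $i$ has, for each $j<i$, a vertex of color $j$ at distance at most $j$. The Grundy packing chromatic number $\Gamma_{\rho}(G)$ is the maximum number of colors used by a greedy packing coloring of $G$. For $\ell\ge 1$, $G^{\ell}$ has vertex set $\{v^{\ell}:v\in V(G)\}$ and edges $u^{\ell}v^{\ell}$ for $u\ne v$ with $d_G(u,v)\le\ell$. $G(k)$ has vertex set $\bigcup_{i=1}^k V(G^i)$ and edge set $\{v^jv^i:v\in V(G),1\le i<j\le k\}\cup\bigcup_{i=1}^kE(G^i)$. For an independent set $A$ of $G(k)$ with $|A|=n$ write $A^i=A\cap V(G^i)$, and let $H_i(A)$ be the subgraph of $G^i$ induced by the vertices $u^i$ with $u^j\notin A$ for all $j<i$. Dense maximization procedure (DMP): if $A^i$ is a maximal independent set of $H_i(A)$ for every $i\in\{1,\dots,k-1\}$, stop. Otherwise take the minimum such $i$ for which this fails; then there is $z^{\ell}\in A$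 with $\ell>i$ such that $A^i\cup\{z^i\}$ is independent in $H_i(A)$; replace $z^{\ell}$ by $z^i$ in $A$ (the result is again an independent set of size $n$) and repeat. $DMP(A)$ is the maximum, over all possible runs of this procedure (all choices made), of the largest $\ell$ such that the resulting set meets $V(G^{\ell})$. *)

theory Defs
  imports "Graph_Theory.Graph_Theory"
begin

text \<open>
  A finite simple graph is a \<^const>\<open>pair_graph\<close>: a finite loop-free digraph whose arc set is
  symmetric, an edge \<open>uv\<close> being the two arcs \<open>(u, v)\<close> and \<open>(v, u)\<close>.
\<close>

text \<open>Least number of edges of a walk; \<open>\<infinity>\<close> between different components.\<close>

definition gdist :: "'a pair_pre_digraph \<Rightarrow> 'a \<Rightarrow> 'a \<Rightarrow> ereal" where
  "gdist G u v = wf_digraph.\<mu> (with_proj G) (\<lambda>_. 1) u v"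

lemma gdist_le_iff:
  assumes "pair_graph G"
  shows "gdist G u v \<le> ereal (real n) \<longleftrightarrow>
           (\<exists>p. pre_digraph.awalk (with_proj G) u p v \<and> length p \<le> n)"
proof -
  interpret pair_graph G by fact
  have cost: "awalk_cost (\<lambda>_. 1) p = real (length p)" for p :: "('a \<times> 'a) list"
    by (induction p) (auto simp: awalk_cost_def)
  have eq: "gdist G u v = (INF p\<in>{p. awalk u p v}. ereal (real (length p)))"
    by (simp add: gdist_def \<mu>_def cost)
  show ?thesis
  proof
    assume "gdist G u v \<le> ereal (real n)"
    also have "\<dots> < ereal (real n + 1)" by simp
    finally obtain p where "awalk u p v" "real (length p) < real n + 1"
      unfolding eq INF_less_iff by auto
    then show "\<exists>p. awalk u p v \<and> length p \<le> n" by (intro exI[of _ p]) linarith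
  next
    assume "\<exists>p. awalk u p v \<and> length p \<le> n"
    then show "gdist G u v \<le> ereal (real n)"
      unfolding eq by (auto intro!: INF_lower2)
  qed
qed

definition independent_set :: "('a, 'b) pre_digraph \<Rightarrow> 'a set \<Rightarrow> bool" where
  "independent_set H S \<longleftrightarrow> S \<subseteq> verts H \<and> (\<forall>u\<in>S. \<forall>v\<in>S. (u, v) \<notin> arcs_ends H)"

definition maximal_independent_set :: "('a, 'b) pre_digraph \<Rightarrow> 'a set \<Rightarrow> bool" where
  "maximal_independent_set H S \<longleftrightarrow>
     independent_set H S \<and> (\<forall>T. independent_set H T \<longrightarrow> S \<subseteq> T \<longrightarrow> T = S)"

definition packing_coloring :: "'a pair_pre_digraph \<Rightarrow> nat \<Rightarrow> ('a \<Rightarrow> nat) \<Rightarrow> bool" where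
  "packing_coloring G k c \<longleftrightarrow>
     c ` pverts G \<subseteq> {1..k} \<and>
     (\<forall>u\<in>pverts G. \<forall>v\<in>pverts G. u \<noteq> v \<longrightarrow> c u = c v \<longrightarrow> gdist G u v > ereal (real (c u)))"

text \<open>The vertices are processed in the order in which they appear in the list \<open>vs\<close>.\<close>

definition produced_greedily :: "'a pair_pre_digraph \<Rightarrow> 'a list \<Rightarrow> ('a \<Rightarrow> nat) \<Rightarrow> bool" where
  "produced_greedily G vs c \<longleftrightarrow>
     (\<forall>t < length vs. c (vs ! t) =
        (LEAST i. 1 \<le> i \<and> \<not> (\<exists>s<t. c (vs ! s) = i \<and> gdist G (vs ! s) (vs ! t) \<le> ereal (real i))))"

definition greedy_packing_coloring :: "'a pair_pre_digraph \<Rightarrow> ('a \<Rightarrow> nat) \<Rightarrow> bool" where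
  "greedy_packing_coloring G c \<longleftrightarrow>
     (\<exists>k. packing_coloring G k c) \<and>
     (\<exists>vs. distinct vs \<and> set vs = pverts G \<and> produced_greedily G vs c)"

definition grundy_packing_number :: "'a pair_pre_digraph \<Rightarrow> nat" where
  "grundy_packing_number G = Max {card (c ` pverts G) | c. greedy_packing_coloring G c}"

text \<open>The copy \<open>v\<^sup>l\<close> of a vertex \<open>v\<close> is the pair \<open>(v, l)\<close>.\<close>

definition power_graph :: "'a pair_pre_digraph \<Rightarrow> nat \<Rightarrow> ('a \<times> nat) pair_pre_digraph" where
  "power_graph G l =
     \<lparr> pverts = {(v, l) | v. v \<in> pverts G},
       parcs = {((u, l), (v, l)) | u v.
                  u \<in> pverts G \<and> v \<in> pverts G \<and> u \<noteq> v \<and> gdist G u v \<le> ereal (real l)} \<rparr>"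

definition layered_graph :: "'a pair_pre_digraph \<Rightarrow> nat \<Rightarrow> ('a \<times> nat) pair_pre_digraph" where
  "layered_graph G k =
     \<lparr> pverts = (\<Union>i\<in>{1..k}. pverts (power_graph G i)),
       parcs = {((v, j), (v, i)) | v i j. v \<in> pverts G \<and> i \<in> {1..k} \<and> j \<in> {1..k} \<and> i \<noteq> j}
               \<union> (\<Union>i\<in>{1..k}. parcs (power_graph G i)) \<rparr>"

definition layer :: "'a pair_pre_digraph \<Rightarrow> nat \<Rightarrow> ('a \<times> nat) set \<Rightarrow> ('a \<times> nat) set" where
  "layer G i A = A \<inter> pverts (power_graph G i)"

definition residual_graph ::
  "'a pair_pre_digraph \<Rightarrow> nat \<Rightarrow> ('a \<times> nat) set \<Rightarrow> ('a \<times> nat, ('a \<times> nat) \<times> ('a \<times> nat)) pre_digraph" where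
  "residual_graph G i A =
     with_proj (power_graph G i) \<restriction> {(u, i) | u. u \<in> pverts G \<and> (\<forall>j. 1 \<le> j \<and> j < i \<longrightarrow> (u, j) \<notin> A)}"

definition dmp_fails :: "'a pair_pre_digraph \<Rightarrow> nat \<Rightarrow> ('a \<times> nat) set \<Rightarrow> nat \<Rightarrow> bool" where
  "dmp_fails G k A i \<longleftrightarrow>
     1 \<le> i \<and> i < k \<and> \<not> maximal_independent_set (residual_graph G i A) (layer G i A)"

definition dmp_stop :: "'a pair_pre_digraph \<Rightarrow> nat \<Rightarrow> ('a \<times> nat) set \<Rightarrow> bool" where
  "dmp_stop G k A \<longleftrightarrow> (\<forall>i. \<not> dmp_fails G k A i)"

definition dmp_step ::
  "'a pair_pre_digraph \<Rightarrow> nat \<Rightarrow> ('a \<times> nat) set \<Rightarrow> ('a \<times> nat) set \<Rightarrow> bool" where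
  "dmp_step G k A B \<longleftrightarrow>
     (\<exists>i z l. dmp_fails G k A i \<and> (\<forall>j<i. \<not> dmp_fails G k A j) \<and>
        (z, l) \<in> A \<and> i < l \<and>
        independent_set (residual_graph G i A) (layer G i A \<union> {(z, i)}) \<and>
        B = (A - {(z, l)}) \<union> {(z, i)})"

definition top_layer :: "'a pair_pre_digraph \<Rightarrow> nat \<Rightarrow> ('a \<times> nat) set \<Rightarrow> nat" where
  "top_layer G k B = Max {l \<in> {1..k}. B \<inter> pverts (power_graph G l) \<noteq> {}}"

definition DMP :: "'a pair_pre_digraph \<Rightarrow> nat \<Rightarrow> ('a \<times> nat) set \<Rightarrow> nat" where
  "DMP G k A = Max {top_layer G k B | B. (dmp_step G k)\<^sup>*\<^sup>* A B \<and> dmp_stop G k B}"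

text \<open>
  The procedure started from \<open>A\<close> refers to the \<open>k\<close> of the graph in which \<open>A\<close> is taken,
  so the members carry this \<open>k\<close>.
\<close>

definition full_independent_sets :: "'a pair_pre_digraph \<Rightarrow> (nat \<times> ('a \<times> nat) set) set" where
  "full_independent_sets G =
     {(k, A). 1 \<le> k \<and> k \<le> card (pverts G) \<and>
        independent_set (with_proj (layered_graph G k)) A \<and> card A = card (pverts G)}"

text \<open>The maxima above are taken over finite sets.\<close>

lemma finite_grundy_values:
  assumes "pair_graph G"
  shows "finite {card (c ` pverts G) | c. greedy_packing_coloring G c}"
proof -
  interpret pair_graph G by fact
  have "{card (c ` pverts G) | c. greedy_packing_coloring G c} \<subseteq> {..card (pverts G)}"
    by (auto intro: card_image_le)
  then show ?thesis by (rule finite_subset) simp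
qed

lemma dmp_run_subset:
  assumes "(dmp_step G k)\<^sup>*\<^sup>* A B" "A \<subseteq> pverts G \<times> {1..k}"
  shows "B \<subseteq> pverts G \<times> {1..k}"
  using assms
  by (induction rule: rtranclp_induct)
     (auto simp: dmp_step_def dmp_fails_def independent_set_def residual_graph_def)

lemma verts_layered_graph: "pverts (layered_graph G k) = pverts G \<times> {1..k}"
  by (auto simp: layered_graph_def power_graph_def)

lemma finite_dmp_values:
  assumes "pair_graph G" "independent_set (with_proj (layered_graph G k)) A"
  shows "finite {top_layer G k B | B. (dmp_step G k)\<^sup>*\<^sup>* A B \<and> dmp_stop G k B}"
proof -
  interpret pair_graph G by fact
  have "A \<subseteq> pverts G \<times> {1..k}"
    using assms(2) by (simp add: independent_set_def verts_layered_graph)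
  then have "{top_layer G k B | B. (dmp_step G k)\<^sup>*\<^sup>* A B \<and> dmp_stop G k B}
               \<subseteq> top_layer G k ` Pow (pverts G \<times> {1..k})"
    using dmp_run_subset by fastforce
  then show ?thesis by (rule finite_subset) simp
qed

lemma finite_full_independent_sets:
  assumes "pair_graph G"
  shows "finite (full_independent_sets G)"
proof -
  interpret pair_graph G by fact
  let ?n = "card (pverts G)"
  have "full_independent_sets G \<subseteq> {1..?n} \<times> Pow (pverts G \<times> {1..?n})"
    by (fastforce simp: full_independent_sets_def independent_set_def verts_layered_graph)
  then show ?thesis by (rule finite_subset) simp
qed

end

theory Submission
  imports Defs
begin

text \<open>
  The independent sets of size \<open>n\<close> in \<open>G(k)\<close> are exactly the graphs \<open>{(v, c v) | v}\<close> of the packing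
  colorings \<open>c\<close> with colors in \<open>{1..k}\<close>. In these terms a step of the procedure lowers the color
  of one vertex and keeps the coloring a packing coloring, so the sum of the colors strictly
  decreases and every run terminates; it stops exactly at the colorings in which every vertex of
  color \<open>i\<close> sees each smaller color \<open>j\<close> within distance \<open>j\<close>. Processing the vertices by increasing
  color shows that the latter are the greedy packing colorings, and these use precisely the colors
  from \<open>1\<close> up to their largest one.
\<close>

section \<open>Colorings: domination, encoding as vertex sets, symmetry of the distance\<close>

definition color_dominating :: "'a pair_pre_digraph \<Rightarrow> ('a \<Rightarrow> nat) \<Rightarrow> bool" where
  "color_dominating G c \<longleftrightarrow>
     (\<forall>v\<in>pverts G. \<forall>j. 1 \<le> j \<longrightarrow> j < c v \<longrightarrow>
        (\<exists>u\<in>pverts G. c u = j \<and> gdist G u v \<le> ereal (real j)))"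

definition color_set :: "'a pair_pre_digraph \<Rightarrow> ('a \<Rightarrow> nat) \<Rightarrow> ('a \<times> nat) set" where
  "color_set G c = (\<lambda>v. (v, c v)) ` pverts G"

lemma in_color_set: "(v, l) \<in> color_set G c \<longleftrightarrow> v \<in> pverts G \<and> c v = l"
  by (auto simp: color_set_def)

lemma card_color_set: "card (color_set G c) = card (pverts G)"
  unfolding color_set_def by (rule card_image) (auto simp: inj_on_def)

text \<open>A walk can be reversed because the arc set is symmetric. Needed since
  \<open>independent_set\<close> tests ordered pairs in both orders, while domination bounds the
  distance in one direction only.\<close>

lemma gdist_le_commute:
  assumes "pair_graph G"
  shows "gdist G u v \<le> ereal (real n) \<longleftrightarrow> gdist G v u \<le> ereal (real n)"
proof -
  interpret pair_graph G by fact
  have rev: "\<exists>q. awalk y q x \<and> length q \<le> n" if "awalk x p y" "length p \<le> n" for x y p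
  proof -
    have "awalk y (rev (map prod.swap p)) x"
      using that(1)
    proof (induction p arbitrary: x)
      case Nil
      then show ?case by (auto simp: awalk_Nil_iff)
    next
      case (Cons e p)
      obtain a b where e: "e = (a, b)" by (cases e)
      have "(b, a) \<in> parcs G"
        using Cons.prems arcs_symmetric by (auto simp: e awalk_Cons_iff)
      then have "awalk b [(b, a)] a"
        using arc_implies_awalk by fastforce
      then show ?case
        using Cons by (auto simp: e awalk_Cons_iff intro: awalk_appendI)
    qed
    then show ?thesis using that(2) by (intro exI[of _ "rev (map prod.swap p)"]) simp
  qed
  show ?thesis
    unfolding gdist_le_iff[OF assms] using rev by blast
qed

section \<open>Greedy colorings and domination\<close>

lemma colors_eq_interval:
  assumes "packing_coloring G k c" "color_dominating G c" "finite (pverts G)" "pverts G \<noteq> {}"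
  shows "c ` pverts G = {1..Max (c ` pverts G)}"
proof
  show "c ` pverts G \<subseteq> {1..Max (c ` pverts G)}"
    using assms by (auto simp: packing_coloring_def)
  \<comment> \<open>A vertex \<open>v\<close> of largest color is dominated by every smaller
    positive color, so no color is skipped.\<close>
  have "Max (c ` pverts G) \<in> c ` pverts G"
    using assms by (intro Max_in) auto
  then obtain v where v: "v \<in> pverts G" "Max (c ` pverts G) = c v" by auto
  show "{1..Max (c ` pverts G)} \<subseteq> c ` pverts G"
  proof
    fix j assume j: "j \<in> {1..Max (c ` pverts G)}"
    show "j \<in> c ` pverts G"
    proof (cases "j = c v")
      case False
      then have "1 \<le> j" "j < c v" using j v by auto
      then show ?thesis using assms(2) v(1) by (auto simp: color_dominating_def)
    qed (use v in auto)
  qed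
qed

text \<open>The \<open>LEAST\<close> in the greedy rule rejects every color below the chosen one,
  and each rejection exhibits an earlier vertex of the rejected color that is close enough.\<close>

lemma greedy_imp_color_dominating:
  assumes "greedy_packing_coloring G c"
  shows "color_dominating G c"
  unfolding color_dominating_def
proof (intro ballI allI impI)
  fix v j assume v: "v \<in> pverts G" and j: "1 \<le> j" "j < c v"
  obtain vs where vs: "set vs = pverts G" "produced_greedily G vs c"
    using assms by (auto simp: greedy_packing_coloring_def)
  obtain t where t: "t < length vs" "vs ! t = v"
    using v vs(1) by (metis in_set_conv_nth)
  have "\<exists>s<t. c (vs ! s) = j \<and> gdist G (vs ! s) v \<le> ereal (real j)"
  proof -
    let ?P = "\<lambda>i. 1 \<le> i \<and>
      \<not> (\<exists>s<t. c (vs ! s) = i \<and> gdist G (vs ! s) (vs ! t) \<le> ereal (real i))"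
    have "c (vs ! t) = Least ?P"
      using vs(2) t(1) unfolding produced_greedily_def by blast
    then have "\<not> ?P j" using j(2) t(2) by (intro not_less_Least) simp
    then show ?thesis using j(1) t(2) by blast
  qed
  then obtain s where "s < t" "c (vs ! s) = j" "gdist G (vs ! s) v \<le> ereal (real j)" by blast
  then show "\<exists>u\<in>pverts G. c u = j \<and> gdist G u v \<le> ereal (real j)"
    using t(1) nth_mem[of s vs, unfolded vs(1)] by (intro bexI[of _ "vs ! s"]) simp_all
qed

lemma color_dominating_imp_greedy:
  assumes "packing_coloring G k c" "color_dominating G c" "finite (pverts G)"
  shows "greedy_packing_coloring G c"
proof -
  obtain ws where ws: "set ws = pverts G" "distinct ws"
    using finite_distinct_list[OF assms(3)] by blast
  \<comment> \<open>Sorting by color puts every dominating vertex before the vertices of larger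
    color that it dominates.\<close>
  define vs where "vs = sort_key c ws"
  have vs: "set vs = pverts G" "distinct vs" "sorted (map c vs)"
    using ws by (auto simp: vs_def)
  have "produced_greedily G vs c"
    unfolding produced_greedily_def
  proof (intro allI impI)
    fix t assume t: "t < length vs"
    let ?P = "\<lambda>i. 1 \<le> i \<and>
      \<not> (\<exists>s<t. c (vs ! s) = i \<and> gdist G (vs ! s) (vs ! t) \<le> ereal (real i))"
    have tV: "vs ! t \<in> pverts G" using nth_mem[OF t] vs(1) by simp
    have "?P (c (vs ! t))"
    proof (intro conjI notI)
      show "1 \<le> c (vs ! t)" using assms(1) tV by (auto simp: packing_coloring_def)
      assume "\<exists>s<t. c (vs ! s) = c (vs ! t) \<and>
        gdist G (vs ! s) (vs ! t) \<le> ereal (real (c (vs ! t)))"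
      then obtain s where s: "s < t" "c (vs ! s) = c (vs ! t)"
        "gdist G (vs ! s) (vs ! t) \<le> ereal (real (c (vs ! t)))" by blast
      have "vs ! s \<noteq> vs ! t" using s(1) t vs(2) by (simp add: nth_eq_iff_index_eq)
      moreover have "vs ! s \<in> pverts G" using nth_mem[of s vs] s(1) t vs(1) by simp
      ultimately show False
        using assms(1) tV s(2,3) unfolding packing_coloring_def
        by (metis (no_types, lifting) not_less)
    qed
    \<comment> \<open>A smaller color \<open>j\<close> is blocked: domination yields a near vertex
      \<open>u\<close> of color \<open>j\<close>, and sortedness places it before position
      \<open>t\<close>.\<close>
    moreover have "c (vs ! t) \<le> j" if Pj: "?P j" for j
    proof (rule ccontr)
      assume "\<not> c (vs ! t) \<le> j"
      then have jlt: "j < c (vs ! t)" by simp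
      then obtain u where u: "u \<in> pverts G" "c u = j" "gdist G u (vs ! t) \<le> ereal (real j)"
        using assms(2) tV Pj unfolding color_dominating_def by blast
      obtain s where s: "s < length vs" "vs ! s = u"
        using u(1) vs(1) by (metis in_set_conv_nth)
      have "s < t"
      proof (rule ccontr)
        assume "\<not> s < t"
        then have "c (vs ! t) \<le> c (vs ! s)"
          using vs(3) s(1) t by (metis length_map not_less nth_map sorted_nth_mono)
        then show False using jlt s u by simp
      qed
      then show False using Pj s u by blast
    qed
    ultimately show "c (vs ! t) = Least ?P"
      by (rule Least_equality[symmetric])
  qed
  then show ?thesis
    using assms(1) vs unfolding greedy_packing_coloring_def by blast
qed

section \<open>Full independent sets as packing colorings\<close>

lemma independent_color_set_iff:
  "independent_set (with_proj (layered_graph G k)) (color_set G c) \<longleftrightarrow> packing_coloring G k c"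
proof -
  have "color_set G c \<subseteq> pverts (layered_graph G k) \<longleftrightarrow> c ` pverts G \<subseteq> {1..k}"
    by (auto simp: verts_layered_graph color_set_def)
  \<comment> \<open>Edges between copies of one vertex never join two members of
    \<open>color_set G c\<close>, which has one copy per vertex; only edges inside a single power
    graph remain.\<close>
  moreover have "((u, c u), (v, c v)) \<in> parcs (layered_graph G k) \<longleftrightarrow>
      u \<noteq> v \<and> c u = c v \<and> gdist G u v \<le> ereal (real (c u))"
    if "c ` pverts G \<subseteq> {1..k}" "u \<in> pverts G" "v \<in> pverts G" for u v
    using that by (fastforce simp: layered_graph_def power_graph_def)
  moreover have "independent_set (with_proj (layered_graph G k)) (color_set G c) \<longleftrightarrow>
      color_set G c \<subseteq> pverts (layered_graph G k) \<and>
      (\<forall>u\<in>pverts G. \<forall>v\<in>pverts G. ((u, c u), (v, c v)) \<notin> parcs (layered_graph G k))"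
    by (auto simp: independent_set_def arcs_ends_def arc_to_ends_def color_set_def)
  ultimately show ?thesis
    unfolding packing_coloring_def by (metis not_le)
qed

text \<open>Copies of one vertex are pairwise adjacent, so \<open>A\<close> contains at most one of
  each; by cardinality it contains exactly one, whose layer is the color.\<close>

lemma full_independent_set_is_color_set:
  assumes "finite (pverts G)" "independent_set (with_proj (layered_graph G k)) A"
    and "card A = card (pverts G)"
  obtains c where "A = color_set G c"
proof -
  have sub: "A \<subseteq> pverts G \<times> {1..k}"
    using assms(2) by (simp add: independent_set_def verts_layered_graph)
  have inj: "inj_on fst A"
  proof (rule inj_onI)
    fix x y assume xy: "x \<in> A" "y \<in> A" "fst x = fst y"
    then have nin: "(x, y) \<notin> parcs (layered_graph G k)"
      using assms(2) by (auto simp: independent_set_def arcs_ends_def arc_to_ends_def)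
    obtain v i j where "x = (v, i)" "y = (v, j)" using xy(3) by (cases x; cases y) auto
    then show "x = y"
      using nin sub xy by (auto simp: layered_graph_def)
  qed
  have "fst ` A = pverts G"
    by (rule card_subset_eq[OF assms(1)]) (use sub inj assms(3) in \<open>auto simp: card_image\<close>)
  then have ex: "\<exists>l. (v, l) \<in> A" if "v \<in> pverts G" for v using that by force
  define c where "c v = (SOME l. (v, l) \<in> A)" for v
  have c: "(v, c v) \<in> A" if "v \<in> pverts G" for v
    unfolding c_def using ex[OF that] by (rule someI_ex)
  have "A = color_set G c"
  proof (intro set_eqI iffI)
    fix x assume x: "x \<in> A"
    then have "fst x \<in> pverts G" using sub by auto
    moreover from this have "x = (fst x, c (fst x))"
      using inj_onD[OF inj _ x c] by simp
    ultimately show "x \<in> color_set G c" unfolding color_set_def by blast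
  qed (auto simp: color_set_def c)
  then show ?thesis by (rule that)
qed

section \<open>Residual graphs, failing layers and stopping in terms of colors\<close>

lemma residual_graph_color_set:
  assumes "packing_coloring G k c"
  shows "residual_graph G i (color_set G c) =
    with_proj (power_graph G i) \<restriction> {(u, i) | u. u \<in> pverts G \<and> i \<le> c u}"
proof -
  have "(\<forall>j. 1 \<le> j \<and> j < i \<longrightarrow> (u, j) \<notin> color_set G c) \<longleftrightarrow> i \<le> c u"
    if "u \<in> pverts G" for u
  proof -
    \<comment> \<open>Colors being positive, the range of \<open>j\<close> in
      \<open>residual_graph\<close> misses no color below \<open>i\<close>.\<close>
    have "1 \<le> c u" using assms that by (auto simp: packing_coloring_def)
    then show ?thesis using that by (auto simp: in_color_set not_less[symmetric])
  qed
  then have "{(u, i) | u. u \<in> pverts G \<and> (\<forall>j. 1 \<le> j \<and> j < i \<longrightarrow> (u, j) \<notin> color_set G c)} =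
    {(u, i) | u. u \<in> pverts G \<and> i \<le> c u}"
    by blast
  then show ?thesis by (simp only: residual_graph_def)
qed

lemma verts_residual_color_set:
  assumes "packing_coloring G k c"
  shows "verts (residual_graph G i (color_set G c)) = {(u, i) | u. u \<in> pverts G \<and> i \<le> c u}"
  unfolding residual_graph_color_set[OF assms] by simp

lemma arcs_ends_residual_color_set:
  assumes "packing_coloring G k c"
  shows "arcs_ends (residual_graph G i (color_set G c)) =
    {((u, i), (v, i)) | u v. u \<in> pverts G \<and> v \<in> pverts G \<and> i \<le> c u \<and> i \<le> c v \<and>
       u \<noteq> v \<and> gdist G u v \<le> ereal (real i)}"
  unfolding residual_graph_color_set[OF assms]
  by (auto simp: power_graph_def arcs_ends_def arc_to_ends_def induce_subgraph_def)

lemma layer_color_set: "layer G i (color_set G c) = {(u, i) | u. u \<in> pverts G \<and> c u = i}"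
  by (auto simp: layer_def power_graph_def color_set_def)

text \<open>Vertices of equal color are far apart, so \<open>dmp_fails\<close> can only be due to a
  lack of maximality.\<close>

lemma independent_layer_color_set:
  assumes "packing_coloring G k c"
  shows "independent_set (residual_graph G i (color_set G c)) (layer G i (color_set G c))"
  unfolding independent_set_def verts_residual_color_set[OF assms]
    arcs_ends_residual_color_set[OF assms] layer_color_set
  using assms by (fastforce simp: packing_coloring_def not_le[symmetric])

text \<open>Because \<open>i < c z\<close>, the copy \<open>(z, i)\<close> lies in the residual
  graph, and the layer is already independent; only the distances from \<open>z\<close> to the
  vertices of color \<open>i\<close> decide.\<close>

lemma independent_extended_layer_iff:
  assumes "pair_graph G" "packing_coloring G k c" "z \<in> pverts G" "i < c z"
  shows "independent_set (residual_graph G i (color_set G c))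
           (layer G i (color_set G c) \<union> {(z, i)}) \<longleftrightarrow>
         (\<forall>u\<in>pverts G. c u = i \<longrightarrow> \<not> gdist G u z \<le> ereal (real i))"
proof
  assume "independent_set (residual_graph G i (color_set G c))
    (layer G i (color_set G c) \<union> {(z, i)})"
  then show "\<forall>u\<in>pverts G. c u = i \<longrightarrow> \<not> gdist G u z \<le> ereal (real i)"
    using assms(3,4)
    unfolding independent_set_def arcs_ends_residual_color_set[OF assms(2)] layer_color_set
    by fastforce
next
  assume far: "\<forall>u\<in>pverts G. c u = i \<longrightarrow> \<not> gdist G u z \<le> ereal (real i)"
  then have far': "\<forall>u\<in>pverts G. c u = i \<longrightarrow> \<not> gdist G z u \<le> ereal (real i)"
    using gdist_le_commute[OF assms(1)] by blast
  show "independent_set (residual_graph G i (color_set G c))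
    (layer G i (color_set G c) \<union> {(z, i)})"
    using independent_layer_color_set[OF assms(2)] far far' assms(3,4)
    unfolding independent_set_def verts_residual_color_set[OF assms(2)]
      arcs_ends_residual_color_set[OF assms(2)] layer_color_set
    by auto
qed

lemma independent_set_subset: "independent_set H T \<Longrightarrow> S \<subseteq> T \<Longrightarrow> independent_set H S"
  by (auto simp: independent_set_def)

text \<open>A larger independent set \<open>T\<close> can be cut down to the layer plus one vertex,
  since independence passes to subsets. That vertex lies in the residual graph but outside the
  layer, so its color exceeds \<open>i\<close>.\<close>

lemma dmp_fails_color_set_iff:
  assumes "pair_graph G" "packing_coloring G k c"
  shows "dmp_fails G k (color_set G c) i \<longleftrightarrow> 1 \<le> i \<and> i < k \<and>
    (\<exists>z\<in>pverts G. i < c z \<and> (\<forall>u\<in>pverts G. c u = i \<longrightarrow> \<not> gdist G u z \<le> ereal (real i)))"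
proof (cases "1 \<le> i \<and> i < k")
  case True
  let ?H = "residual_graph G i (color_set G c)" and ?L = "layer G i (color_set G c)"
  have "\<not> maximal_independent_set ?H ?L \<longleftrightarrow>
    (\<exists>z\<in>pverts G. i < c z \<and> independent_set ?H (?L \<union> {(z, i)}))" (is "?l \<longleftrightarrow> ?r")
  proof
    assume ?l
    then obtain T where T: "independent_set ?H T" "?L \<subseteq> T" "T \<noteq> ?L"
      using independent_layer_color_set[OF assms(2)] True
      by (auto simp: maximal_independent_set_def)
    then obtain x where x: "x \<in> T" "x \<notin> ?L" by blast
    have "x \<in> verts ?H" using T x by (auto simp: independent_set_def)
    then obtain z where "x = (z, i)" "z \<in> pverts G" "i \<le> c z"
      using verts_residual_color_set[OF assms(2)] True by auto
    moreover from this x have "c z \<noteq> i" by (auto simp: layer_color_set)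
    moreover have "independent_set ?H (?L \<union> {x})"
      by (rule independent_set_subset[OF T(1)]) (use T x in auto)
    ultimately show ?r by force
  next
    assume ?r
    then show ?l by (auto simp: maximal_independent_set_def layer_color_set)
  qed
  then show ?thesis
    using True independent_extended_layer_iff[OF assms] by (auto simp: dmp_fails_def)
qed (auto simp: dmp_fails_def)

lemma dmp_stop_color_set_iff:
  assumes "pair_graph G" "packing_coloring G k c"
  shows "dmp_stop G k (color_set G c) \<longleftrightarrow> color_dominating G c"
proof -
  \<comment> \<open>The procedure tests only layers below \<open>k\<close>; as colors are at most
    \<open>k\<close>, this covers every \<open>j < c v\<close>.\<close>
  have "c v \<le> k" if "v \<in> pverts G" for v using assms(2) that by (auto simp: packing_coloring_def)
  then show ?thesis
    unfolding dmp_stop_def dmp_fails_color_set_iff[OF assms] color_dominating_def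
    by (meson less_le_trans)
qed

section \<open>Runs of the procedure: invariance, progress, termination\<close>

lemma dmp_step_color_set:
  assumes "pair_graph G" "packing_coloring G k c" "dmp_step G k (color_set G c) B"
  obtains c' where "B = color_set G c'" "packing_coloring G k c'"
    "sum c' (pverts G) < sum c (pverts G)"
proof -
  interpret pair_graph G by fact
  obtain i z l where step: "dmp_fails G k (color_set G c) i" "(z, l) \<in> color_set G c" "i < l"
    "independent_set (residual_graph G i (color_set G c))
       (layer G i (color_set G c) \<union> {(z, i)})"
    "B = (color_set G c - {(z, l)}) \<union> {(z, i)}"
    using assms(3) by (auto simp: dmp_step_def)
  have z: "z \<in> pverts G" "c z = l" using step(2) by (auto simp: in_color_set)
  have i: "1 \<le> i" "i < k" using step(1) by (auto simp: dmp_fails_def)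
  have far: "\<forall>u\<in>pverts G. c u = i \<longrightarrow> \<not> gdist G u z \<le> ereal (real i)"
    using independent_extended_layer_iff[OF assms(1,2) z(1)] step z by blast
  then have far': "\<forall>u\<in>pverts G. c u = i \<longrightarrow> \<not> gdist G z u \<le> ereal (real i)"
    using gdist_le_commute[OF assms(1)] by blast
  show ?thesis
  proof
    show "B = color_set G (c(z := i))"
      using step(5) z by (auto simp: color_set_def)
    \<comment> \<open>Only pairs containing \<open>z\<close> are affected, and \<open>far\<close>
      and \<open>far'\<close> settle these in both orders.\<close>
    show "packing_coloring G k (c(z := i))"
      using assms(2) far far' i by (auto simp: packing_coloring_def not_le[symmetric])
    show "sum (c(z := i)) (pverts G) < sum c (pverts G)"
      by (rule sum_strict_mono_ex1) (use z step(3) in auto)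
  qed
qed

lemma dmp_run_color_set:
  assumes "pair_graph G" "packing_coloring G k c" "(dmp_step G k)\<^sup>*\<^sup>* (color_set G c) B"
  obtains c' where "B = color_set G c'" "packing_coloring G k c'"
proof -
  have "\<exists>c'. B = color_set G c' \<and> packing_coloring G k c'"
    using assms(3)
  proof (induction rule: rtranclp_induct)
    case base
    then show ?case using assms(2) by blast
  next
    case (step B C)
    then show ?case using dmp_step_color_set[OF assms(1)] by metis
  qed
  then show ?thesis using that by blast
qed

text \<open>No run gets stuck before stopping: the least failing layer always admits a vertex of
  larger color.\<close>

lemma dmp_progress:
  assumes "pair_graph G" "packing_coloring G k c" "\<not> dmp_stop G k (color_set G c)"
  obtains B where "dmp_step G k (color_set G c) B"
proof -
  let ?A = "color_set G c"
  define i where "i = (LEAST i. dmp_fails G k ?A i)"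
  have fails: "dmp_fails G k ?A i"
    using assms(3) unfolding i_def dmp_stop_def by (auto intro: LeastI_ex)
  have min: "\<forall>j<i. \<not> dmp_fails G k ?A j"
    unfolding i_def using not_less_Least by blast
  obtain z where z: "z \<in> pverts G" "i < c z"
    "\<forall>u\<in>pverts G. c u = i \<longrightarrow> \<not> gdist G u z \<le> ereal (real i)"
    using fails dmp_fails_color_set_iff[OF assms(1,2)] by blast
  have "independent_set (residual_graph G i ?A) (layer G i ?A \<union> {(z, i)})"
    using independent_extended_layer_iff[OF assms(1,2)] z by blast
  moreover have "(z, c z) \<in> ?A" using z by (simp add: in_color_set)
  ultimately show ?thesis
    using fails min z(2) that unfolding dmp_step_def by blast
qed

text \<open>Makes the set under \<open>Max\<close> in \<open>DMP\<close> nonempty. The induction is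
  on the sum of colors, which each step decreases.\<close>

lemma dmp_terminates:
  assumes "pair_graph G" "packing_coloring G k c"
  shows "\<exists>B. (dmp_step G k)\<^sup>*\<^sup>* (color_set G c) B \<and> dmp_stop G k B"
  using assms(2)
proof (induction "sum c (pverts G)" arbitrary: c rule: less_induct)
  case less
  show ?case
  proof (cases "dmp_stop G k (color_set G c)")
    case False
    then obtain B where B: "dmp_step G k (color_set G c) B"
      using dmp_progress[OF assms(1) less.prems] by blast
    then obtain c' where "B = color_set G c'" "packing_coloring G k c'"
      "sum c' (pverts G) < sum c (pverts G)"
      using dmp_step_color_set[OF assms(1) less.prems] by blast
    then show ?thesis
      using less.hyps B by (meson converse_rtranclp_into_rtranclp)
  qed blast
qed

lemma top_layer_color_set:
  assumes "packing_coloring G k c"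
  shows "top_layer G k (color_set G c) = Max (c ` pverts G)"
proof -
  have "{l \<in> {1..k}. color_set G c \<inter> pverts (power_graph G l) \<noteq> {}} = c ` pverts G"
    using assms by (fastforce simp: power_graph_def color_set_def packing_coloring_def)
  then show ?thesis by (simp add: top_layer_def)
qed

section \<open>Comparison of the two maxima\<close>

lemma DMP_is_greedy_value:
  assumes "pair_graph G" "pverts G \<noteq> {}" "(k, A) \<in> full_independent_sets G"
  shows "\<exists>c. greedy_packing_coloring G c \<and> DMP G k A = card (c ` pverts G)"
proof -
  interpret pair_graph G by fact
  have A: "independent_set (with_proj (layered_graph G k)) A" "card A = card (pverts G)"
    using assms(3) by (auto simp: full_independent_sets_def)
  obtain c where c: "A = color_set G c"
    using full_independent_set_is_color_set[OF finite_verts A] by auto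
  have pc: "packing_coloring G k c" using A(1) c independent_color_set_iff by blast
  let ?S = "{top_layer G k B | B. (dmp_step G k)\<^sup>*\<^sup>* A B \<and> dmp_stop G k B}"
  have "?S \<noteq> {}" using dmp_terminates[OF assms(1) pc] c by blast
  \<comment> \<open>The maximum of a finite nonempty set is attained, so some run realizes
    it.\<close>
  then have "DMP G k A \<in> ?S"
    unfolding DMP_def by (rule Max_in[OF finite_dmp_values[OF assms(1) A(1)]])
  then obtain B where B: "DMP G k A = top_layer G k B" "(dmp_step G k)\<^sup>*\<^sup>* A B" "dmp_stop G k B"
    by blast
  obtain d where d: "B = color_set G d" "packing_coloring G k d"
    using dmp_run_color_set[OF assms(1) pc] B(2) c by blast
  have dom: "color_dominating G d"
    using B(3) d dmp_stop_color_set_iff[OF assms(1)] by blast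
  have fin: "finite (pverts G)" using finite_verts by simp
  \<comment> \<open>The stopped coloring uses exactly the colors from 1 to its largest, so the top
    layer equals the number of colors.\<close>
  have "DMP G k A = card (d ` pverts G)"
    using B(1) d top_layer_color_set colors_eq_interval[OF d(2) dom fin assms(2)]
    by (metis card_atLeastAtMost diff_Suc_1 One_nat_def)
  then show ?thesis
    using color_dominating_imp_greedy[OF d(2) dom fin] by blast
qed

text \<open>The greedy coloring itself gives the starting set: the procedure stops there at once, so
  the empty run contributes its top layer to \<open>DMP\<close>.\<close>

lemma greedy_value_le_DMP:
  assumes "pair_graph G" "pverts G \<noteq> {}" "greedy_packing_coloring G c"
  shows "\<exists>(k, A)\<in>full_independent_sets G. card (c ` pverts G) \<le> DMP G k A"
proof -
  interpret pair_graph G by fact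
  have fin: "finite (pverts G)" using finite_verts by simp
  obtain k where k: "packing_coloring G k c"
    using assms(3) by (auto simp: greedy_packing_coloring_def)
  have dom: "color_dominating G c" by (rule greedy_imp_color_dominating[OF assms(3)])
  \<comment> \<open>The bound \<open>k\<close> from \<open>packing_coloring\<close> may exceed the
    number of vertices. The largest color \<open>m\<close> equals the number of colors, hence lies
    in the range required by \<open>full_independent_sets\<close>.\<close>
  define m where "m = Max (c ` pverts G)"
  have img: "c ` pverts G = {1..m}"
    unfolding m_def by (rule colors_eq_interval[OF k dom fin assms(2)])
  have card: "card (c ` pverts G) = m" by (simp add: img)
  have pc: "packing_coloring G m c" using k img by (auto simp: packing_coloring_def)
  let ?A = "color_set G c"
  have ind: "independent_set (with_proj (layered_graph G m)) ?A"
    using pc independent_color_set_iff by blast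
  have "1 \<le> m" using img assms(2) by (cases m) auto
  moreover have "m \<le> card (pverts G)" using card card_image_le[OF fin] by metis
  ultimately have mem: "(m, ?A) \<in> full_independent_sets G"
    using ind by (simp add: full_independent_sets_def card_color_set)
  have "dmp_stop G m ?A" using dmp_stop_color_set_iff[OF assms(1) pc] dom by blast
  then have "top_layer G m ?A \<le> DMP G m ?A"
    unfolding DMP_def by (intro Max_ge[OF finite_dmp_values[OF assms(1) ind]]) blast
  then have "card (c ` pverts G) \<le> DMP G m ?A"
    by (simp add: card top_layer_color_set[OF pc] flip: m_def)
  then show ?thesis using mem by blast
qed

text \<open>Giving all vertices different colors is a packing coloring, so the maximum over starting
  sets is taken over a nonempty set.\<close>

lemma full_independent_sets_nonempty:
  assumes "finite (pverts G)" "pverts G \<noteq> {}"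
  shows "full_independent_sets G \<noteq> {}"
proof -
  let ?n = "card (pverts G)"
  obtain f where f: "bij_betw f (pverts G) {1..?n}"
    using finite_same_card_bij[OF assms(1), of "{1..?n}"] by auto
  then have "packing_coloring G ?n f"
    by (auto simp: packing_coloring_def bij_betw_def inj_on_def)
  then have "(?n, color_set G f) \<in> full_independent_sets G"
    using independent_color_set_iff assms
    by (auto simp: full_independent_sets_def card_color_set Suc_le_eq card_gt_0_iff)
  then show ?thesis by blast
qed

theorem theorem4:
  fixes G :: "'a pair_pre_digraph"
  assumes "pair_graph G" and "pverts G \<noteq> {}"
  shows "grundy_packing_number G = Max ((\<lambda>(k, A). DMP G k A) ` full_independent_sets G)"
proof -
  interpret pair_graph G by fact
  let ?S = "{card (c ` pverts G) | c. greedy_packing_coloring G c}"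
  let ?T = "(\<lambda>(k, A). DMP G k A) ` full_independent_sets G"
  have finS: "finite ?S" by (rule finite_grundy_values[OF assms(1)])
  have finT: "finite ?T" using finite_full_independent_sets[OF assms(1)] by simp
  have neT: "?T \<noteq> {}" using full_independent_sets_nonempty[OF _ assms(2)] finite_verts by simp
  \<comment> \<open>This inclusion gives one inequality and, as \<open>?T\<close> is nonempty, also
    the existence of a greedy packing coloring.\<close>
  have TS: "?T \<subseteq> ?S" using DMP_is_greedy_value[OF assms] by fastforce
  show ?thesis
    unfolding grundy_packing_number_def
  proof (rule antisym)
    show "Max ?T \<le> Max ?S" by (rule Max_mono[OF TS neT finS])
    have "s \<le> Max ?T" if "s \<in> ?S" for s
    proof -
      obtain k A where kA: "(k, A) \<in> full_independent_sets G" "s \<le> DMP G k A"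
        using \<open>s \<in> ?S\<close> greedy_value_le_DMP[OF assms] by blast
      then have "DMP G k A \<in> ?T" by force
      then show ?thesis using kA(2) Max_ge[OF finT] by (meson order_trans)
    qed
    moreover have "?S \<noteq> {}" using TS neT by blast
    ultimately show "Max ?S \<le> Max ?T" using finS by simp
  qed
qed

end
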